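(* Let $g$ be either $\omega$ or $\Omega$, where for a positive integer $n$, $\omega(n)$ is the number of distinct prime factors of $n$ and $\Omega(n)$ is the number of prime factors of $n$ counted with multiplicity. Then for every ergodic dynamical system $(X,\mathcal{A},\mu,\tau)$ and every $f\in L^{1}(X)$, $$\lim_{K\to\infty}\frac{1}{S_{g,K}}\sum_{n=1}^{K} g(n)f(\tau^{n}x)=\int_{X}f\,d\mu\quad\text{for $\mu$-a.e. }x\in X,$$ where $S_{g,K}=\sum_{n\le K}g(n)$.
   Context: If $n=p_1^{\alpha_1}\cdots p_k^{\alpha_k}$ is the prime factorization of $n$ (distinct primes $p_i$, exponents $\alpha_i\ge 1$), then $\omega(n)=k$ and $\Omega(n)=\alpha_1+\dots+\alpha_k$; in particular $\omega(1)=\Omega(1)=0$. For $K\in\mathbb{N}$, $S_{g,K}=\sum_{n=1}^{K}g(n)$, which is positive for $K\ge 2$. An ergodic dynamical system $(X,\mathcal{A},\mu,\tau)$ consists of a probability space $(X,\mathcal{A},\mu)$ and a measure preserving ergodic transformation $\tau:X\to X$. *)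

theory Defs
  imports "HOL-Probability.Probability" "HOL-Computational_Algebra.Primes"
begin

definition prime_omega :: "nat \<Rightarrow> nat" where
  "prime_omega n = card (prime_factors n)"

definition prime_Omega :: "nat \<Rightarrow> nat" where
  "prime_Omega n = size (prime_factorization n)"

definition weight_sum :: "(nat \<Rightarrow> nat) \<Rightarrow> nat \<Rightarrow> nat" where
  "weight_sum g K = (\<Sum>n=1..K. g n)"

(* The map need not be invertible. Measurability also gives that it maps space M into itself. *)
definition measure_preserving_map :: "'a measure \<Rightarrow> ('a \<Rightarrow> 'a) \<Rightarrow> bool" where
  "measure_preserving_map M T \<longleftrightarrow>
     T \<in> measurable M M \<and>
     (\<forall>A\<in>sets M. emeasure M (T -` A \<inter> space M) = emeasure M A)"

definition ergodic_map :: "'a measure \<Rightarrow> ('a \<Rightarrow> 'a) \<Rightarrow> bool" where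
  "ergodic_map M T \<longleftrightarrow>
     (\<forall>A\<in>sets M. T -` A \<inter> space M = A \<longrightarrow> measure M A = 0 \<or> measure M A = 1)"

locale ergodic_system = prob_space M for M :: "'a measure" +
  fixes T :: "'a \<Rightarrow> 'a"
  assumes measure_preserving: "measure_preserving_map M T"
    and ergodic: "ergodic_map M T"

end

theory Submission
  imports Defs "HOL-Computational_Algebra.Squarefree" "HOL-Library.Discrete_Functions"
begin

text \<open>
  Let \<open>L K\<close> be the sum of \<open>1/p\<close> over the primes \<open>p \<le> K\<close>, so that \<open>g\<close> has mean about \<open>L K\<close> on
  \<open>{1..K}\<close>. By Turan's variance bound, \<open>g / L K\<close> is close to \<open>1\<close> on average; hence replacing the weights by
  \<open>1\<close> changes nothing for bounded \<open>f\<close>, and Birkhoff's theorem applies.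

  For integrable \<open>f\<close>, cut the weights at \<open>C * L K\<close>. The cut weights are at most \<open>C\<close> after normalization, so the
  unbounded part of \<open>f\<close> contributes at most \<open>C + 1\<close> times its \<open>L\<^sup>1\<close> norm, again by Birkhoff's theorem. What was
  cut off is so small, by an exponential moment of \<open>prime_Omega\<close>, that its averages over the dyadic
  scales \<open>K = 2 ^ k\<close> have summable \<open>L\<^sup>1\<close> norms and therefore tend to \<open>0\<close> almost everywhere.
  No maximal inequality for the weighted averages is needed.
\<close>

section \<open>Birkhoff's ergodic theorem\<close>

context ergodic_system
begin

section \<open>Invariance of integrals under the iterates of \<open>T\<close>\<close>

lemma measurable_T [measurable]: "T \<in> measurable M M"
  using measure_preserving by (simp add: measure_preserving_map_def)

lemma T_space: "x \<in> space M \<Longrightarrow> T x \<in> space M"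
  using measurable_T by (rule measurable_space)

lemma distr_T: "distr M M T = M"
  using measure_preserving
  by (intro measure_eqI) (auto simp: emeasure_distr measure_preserving_map_def)

lemma
  fixes f :: "'a \<Rightarrow> 'b::{banach, second_countable_topology}"
  assumes "integrable M f"
  shows integrable_T: "integrable M (\<lambda>x. f (T x))"
    and integral_T: "(\<integral>x. f (T x) \<partial>M) = (\<integral>x. f x \<partial>M)"
  using integrable_distr[OF measurable_T, of f] integral_distr[OF measurable_T, of f] assms
  by (simp_all add: distr_T)

lemma
  fixes f :: "'a \<Rightarrow> 'b::{banach, second_countable_topology}"
  assumes "integrable M f"
  shows integrable_T_funpow: "integrable M (\<lambda>x. f ((T ^^ n) x))"
    and integral_T_funpow: "(\<integral>x. f ((T ^^ n) x) \<partial>M) = (\<integral>x. f x \<partial>M)"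
proof -
  have "integrable M (\<lambda>x. f ((T ^^ n) x)) \<and> (\<integral>x. f ((T ^^ n) x) \<partial>M) = (\<integral>x. f x \<partial>M)"
  proof (induction n)
    case (Suc n)
    then show ?case
      using integrable_T[of "\<lambda>x. f ((T ^^ n) x)"] integral_T[of "\<lambda>x. f ((T ^^ n) x)"]
      by (simp add: funpow_Suc_right del: funpow.simps(2))
  qed (use assms in simp)
  then show "integrable M (\<lambda>x. f ((T ^^ n) x))"
    and "(\<integral>x. f ((T ^^ n) x) \<partial>M) = (\<integral>x. f x \<partial>M)" by auto
qed

section \<open>Maximal orbit sums and pointwise convergence of Birkhoff averages\<close>

text \<open>By recursion, this is the maximum of the Birkhoff sums over \<open>1, \<dots>, N + 1\<close> points of the orbit.\<close>
primrec max_orbit_sum :: "('a \<Rightarrow> real) \<Rightarrow> nat \<Rightarrow> 'a \<Rightarrow> real" where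
  "max_orbit_sum f 0 x = f x"
| "max_orbit_sum f (Suc N) x = f x + max 0 (max_orbit_sum f N (T x))"

lemma max_orbit_sum_Suc_ge: "max_orbit_sum f N x \<le> max_orbit_sum f (Suc N) x"
proof (induction N arbitrary: x)
  case (Suc N)
  from Suc[of "T x"] show ?case by (simp add: max_def)
qed simp

lemma max_orbit_sum_mono: "N \<le> N' \<Longrightarrow> max_orbit_sum f N x \<le> max_orbit_sum f N' x"
  by (rule lift_Suc_mono_le[of "\<lambda>N. max_orbit_sum f N x"]) (rule max_orbit_sum_Suc_ge)

lemma orbit_sum_le: "(\<Sum>i<Suc N. f ((T ^^ i) x)) \<le> max_orbit_sum f N x"
proof (induction N arbitrary: x)
  case (Suc N)
  have "(\<Sum>i<Suc (Suc N). f ((T ^^ i) x)) = f x + (\<Sum>i<Suc N. f ((T ^^ i) (T x)))"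
    by (subst sum.lessThan_Suc_shift) (simp add: funpow_Suc_right del: funpow.simps(2) sum.lessThan_Suc)
  also have "\<dots> \<le> max_orbit_sum f (Suc N) x"
    using Suc[of "T x"] by simp
  finally show ?case .
qed simp

lemma integrable_max_orbit_sum:
  assumes "integrable M f"
  shows "integrable M (max_orbit_sum f N)"
proof (induction N)
  case 0
  then show ?case using assms by (simp add: max_orbit_sum.simps(1)[abs_def])
next
  case (Suc N)
  show ?case
    unfolding max_orbit_sum.simps(2)[abs_def]
    using assms integrable_T[OF Suc] by simp
qed

text \<open>The set \<open>E\<close> where the maximal sums are unbounded is invariant, hence null
  or of full measure. On \<open>E\<close> the difference
  \<open>max_orbit_sum f (Suc N) x - max_orbit_sum f N (T x)\<close> is eventually
  \<open>f x\<close>, while its integral over \<open>E\<close> is never negative. So a set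
  \<open>E\<close> of full measure would force the integral of \<open>f\<close> to be
  nonnegative.\<close>

lemma orbit_sums_bounded_above:
  fixes f :: "'a \<Rightarrow> real"
  assumes f: "integrable M f" and neg: "(\<integral>x. f x \<partial>M) < 0"
  shows "AE x in M. \<exists>c. \<forall>n. (\<Sum>i<n. f ((T ^^ i) x)) \<le> c"
proof -
  let ?F = "max_orbit_sum f"
  \<comment> \<open>Bounds \<open>c\<close> in the naturals make \<open>E\<close> a countable
    combination of measurable sets.\<close>
  define E where "E = {x \<in> space M. \<forall>c::nat. \<exists>N. ?F N x > real c}"
  note intF = integrable_max_orbit_sum[OF f]
  have [measurable]: "?F N \<in> borel_measurable M" for N
    using intF by blast
  have [measurable]: "E \<in> sets M"
    unfolding E_def by measurable
  have unbounded_iff: "(\<forall>c::nat. \<exists>N. ?F N x > real c) \<longleftrightarrow> filterlim (\<lambda>N. ?F N x) at_top sequentially" for x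
  proof
    assume *: "\<forall>c::nat. \<exists>N. ?F N x > real c"
    show "filterlim (\<lambda>N. ?F N x) at_top sequentially"
      unfolding filterlim_at_top
    proof
      fix Z :: real
      obtain c :: nat where c: "Z \<le> real c" using real_arch_simple by blast
      obtain N where "?F N x > real c" using * by blast
      then show "\<forall>\<^sub>F N in sequentially. Z \<le> ?F N x"
        using c max_orbit_sum_mono[of N _ f x]
        by (intro eventually_sequentiallyI[of N]) (meson less_imp_le order_trans)
    qed
  next
    assume *: "filterlim (\<lambda>N. ?F N x) at_top sequentially"
    show "\<forall>c::nat. \<exists>N. ?F N x > real c"
    proof
      fix c :: nat
      have "\<forall>\<^sub>F N in sequentially. ?F N x > real c"
        using * by (simp add: filterlim_at_top_dense)
      then show "\<exists>N. ?F N x > real c"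
        by (auto simp: eventually_sequentially)
    qed
  qed
  \<comment> \<open>\<open>ergodic_map\<close> speaks of sets that equal their preimage exactly, so
    the equivalence is shown at every point of the space. By the recursion, passing from
    \<open>x\<close> to \<open>T x\<close> changes a large maximum only by
    \<open>f x\<close>.\<close>
  have inv: "T x \<in> E \<longleftrightarrow> x \<in> E" if x: "x \<in> space M" for x
  proof -
    have "(\<forall>c::nat. \<exists>N. ?F N (T x) > real c) \<longleftrightarrow> (\<forall>c::nat. \<exists>N. ?F N x > real c)"
    proof safe
      fix c :: nat assume *: "\<forall>c::nat. \<exists>N. ?F N (T x) > real c"
      obtain d :: nat where d: "real c - f x \<le> real d" using real_arch_simple by blast
      obtain N where "?F N (T x) > real d" using * by blast
      with d have "?F (Suc N) x > real c" by simp
      then show "\<exists>N. ?F N x > real c" by blast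
    next
      fix c :: nat assume *: "\<forall>c::nat. \<exists>N. ?F N x > real c"
      obtain d :: nat where d: "real c + \<bar>f x\<bar> \<le> real d" using real_arch_simple by blast
      obtain N where N: "?F N x > real d" using * by blast
      with max_orbit_sum_Suc_ge[of f N x] have "?F (Suc N) x > real d" by linarith
      with d have "max 0 (?F N (T x)) > real c" by simp
      then have "?F N (T x) > real c" by (simp add: max_def split: if_splits)
      then show "\<exists>N. ?F N (T x) > real c" by blast
    qed
    then show ?thesis using x T_space[OF x] by (simp add: E_def)
  qed
  have "T -` E \<inter> space M = E"
    using inv sets.sets_into_space[OF \<open>E \<in> sets M\<close>] by auto
  then have E01: "prob E = 0 \<or> prob E = 1"
    using ergodic \<open>E \<in> sets M\<close> by (auto simp: ergodic_map_def)
  have "(\<integral>x. indicator E x * f x \<partial>M) \<ge> 0"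
  proof (rule tendsto_lowerbound)
    let ?G = "\<lambda>N x. indicator E x * ?F N x :: real"
    let ?D = "\<lambda>N x. indicator E x * (?F (Suc N) x - ?F N (T x)) :: real"
    show "(\<lambda>N. \<integral>x. ?D N x \<partial>M) \<longlonglongrightarrow> (\<integral>x. indicator E x * f x \<partial>M)"
    proof (rule integral_dominated_convergence[where w = "\<lambda>x. \<bar>f x\<bar> + \<bar>f (T x)\<bar>"])
      show "integrable M (\<lambda>x. \<bar>f x\<bar> + \<bar>f (T x)\<bar>)"
        using f integrable_T[OF f] by auto
      show "(\<lambda>x. indicator E x * f x) \<in> borel_measurable M"
        using f by measurable
      show "?D N \<in> borel_measurable M" for N
        by measurable
      show "AE x in M. norm (?D N x) \<le> \<bar>f x\<bar> + \<bar>f (T x)\<bar>" for N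
      proof (rule AE_I2)
        fix x
        \<comment> \<open>On \<open>E\<close>, \<open>?D N x\<close> is
          \<open>f x + max 0 (- ?F N (T x))\<close>, so a lower bound for \<open>?F N (T x)\<close>
          that does not depend on \<open>N\<close> dominates it.\<close>
        have "?F N (T x) \<ge> f (T x)"
          using max_orbit_sum_mono[of 0 N f "T x"] by simp
        then show "norm (?D N x) \<le> \<bar>f x\<bar> + \<bar>f (T x)\<bar>"
          by (auto simp: indicator_def)
      qed
      show "AE x in M. (\<lambda>N. ?D N x) \<longlonglongrightarrow> indicator E x * f x"
      proof (rule AE_I2)
        fix x assume x: "x \<in> space M"
        show "(\<lambda>N. ?D N x) \<longlonglongrightarrow> indicator E x * f x"
        proof (cases "x \<in> E")
          case True
          then have "filterlim (\<lambda>N. ?F N (T x)) at_top sequentially"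
            using inv[OF x] unbounded_iff[of "T x"] by (simp add: E_def)
          then have "\<forall>\<^sub>F N in sequentially. ?F N (T x) \<ge> 0"
            by (simp add: filterlim_at_top)
          then have "\<forall>\<^sub>F N in sequentially. indicator E x * f x = ?D N x"
            by eventually_elim simp
          then show ?thesis
            by (rule Lim_transform_eventually[OF tendsto_const])
        qed simp
      qed
    qed
    have iG: "integrable M (?G N)" for N
      using integrable_mult_indicator[OF \<open>E \<in> sets M\<close> intF[of N]] by simp
    \<comment> \<open>As \<open>E\<close> and the measure are invariant, the second term of
      \<open>?D N\<close> integrates to the integral of \<open>?G N\<close>. The integrals of
      \<open>?G\<close> increase with \<open>N\<close>.\<close>
    have "(\<integral>x. ?D N x \<partial>M) \<ge> 0" for N
    proof -
      have "(\<integral>x. ?D N x \<partial>M) = (\<integral>x. ?G (Suc N) x - ?G N (T x) \<partial>M)"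
        by (intro Bochner_Integration.integral_cong refl)
           (simp add: indicator_def inv right_diff_distrib del: max_orbit_sum.simps)
      also have "\<dots> = (\<integral>x. ?G (Suc N) x \<partial>M) - (\<integral>x. ?G N x \<partial>M)"
        using iG integrable_T[OF iG[of N]] integral_T[OF iG[of N]]
        by (simp del: max_orbit_sum.simps)
      also have "\<dots> \<ge> 0"
        using integral_mono[OF iG[of N] iG[of "Suc N"]] max_orbit_sum_Suc_ge[of f N]
        by (simp add: mult_left_mono del: max_orbit_sum.simps)
      finally show ?thesis .
    qed
    then show "\<forall>\<^sub>F N in sequentially. 0 \<le> (\<integral>x. ?D N x \<partial>M)" by simp
  qed simp
  moreover have "(\<integral>x. indicator E x * f x \<partial>M) = (\<integral>x. f x \<partial>M)" if "prob E = 1"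
  proof (rule integral_cong_AE)
    have "AE x in M. x \<in> E" using that by (simp add: prob_eq_1)
    then show "AE x in M. indicator E x * f x = f x" by eventually_elim simp
  qed (use f in measurable)
  ultimately have "prob E = 0" using neg E01 by fastforce
  then have "AE x in M. x \<notin> E" by (simp add: prob_eq_0)
  with AE_space show ?thesis
  proof eventually_elim
    case (elim x)
    then obtain c :: nat where c: "\<And>N. ?F N x \<le> real c"
      by (auto simp: E_def not_less)
    have "(\<Sum>i<n. f ((T ^^ i) x)) \<le> real c" for n
    proof (cases n)
      case (Suc N)
      show ?thesis unfolding Suc by (rule order_trans[OF orbit_sum_le c])
    qed simp
    then show ?case by blast
  qed
qed

text \<open>Subtracting the mean plus \<open>\<epsilon> / 2\<close> leaves a function of negative
  integral, whose orbit sums are bounded by some \<open>c\<close>. The other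
  \<open>\<epsilon> / 2\<close> absorbs \<open>c / n\<close> for large \<open>n\<close>.\<close>

lemma birkhoff_upper:
  fixes f :: "'a \<Rightarrow> real"
  assumes f: "integrable M f" and "\<epsilon> > 0"
  shows "AE x in M. \<forall>\<^sub>F n in sequentially.
           (\<Sum>i<n. f ((T ^^ i) x)) / real n \<le> (\<integral>x. f x \<partial>M) + \<epsilon>"
proof -
  define a where "a = (\<integral>x. f x \<partial>M) + \<epsilon> / 2"
  have "AE x in M. \<exists>c. \<forall>n. (\<Sum>i<n. f ((T ^^ i) x) - a) \<le> c"
    using f \<open>\<epsilon> > 0\<close> by (intro orbit_sums_bounded_above) (auto simp: a_def prob_space)
  then show ?thesis
  proof eventually_elim
    case (elim x)
    then obtain c where c: "\<And>n. (\<Sum>i<n. f ((T ^^ i) x)) \<le> c + real n * a"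
      by (auto simp: sum_subtractf algebra_simps)
    have "\<forall>\<^sub>F n in sequentially. real n \<ge> max 1 (2 * c / \<epsilon>)"
      using filterlim_real_sequentially unfolding filterlim_at_top by blast
    then show ?case
    proof eventually_elim
      case (elim n)
      then have "c \<le> \<epsilon> / 2 * real n" "real n > 0"
        using \<open>\<epsilon> > 0\<close> by (auto simp: field_simps)
      with c[of n] show ?case by (simp add: a_def field_simps)
    qed
  qed
qed

text \<open>The lower bound is the upper bound for \<open>- f\<close>. Tolerances
  \<open>inverse (Suc m)\<close> keep the exceptional null sets countable in number.\<close>

lemma birkhoff_real:
  fixes f :: "'a \<Rightarrow> real"
  assumes f: "integrable M f"
  shows "AE x in M. (\<lambda>n. (\<Sum>i<n. f ((T ^^ i) x)) / real n) \<longlonglongrightarrow> (\<integral>x. f x \<partial>M)"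
proof -
  have "AE x in M. \<forall>m::nat. \<forall>\<^sub>F n in sequentially.
           (\<Sum>i<n. f ((T ^^ i) x)) / real n \<le> (\<integral>x. f x \<partial>M) + inverse (Suc m)"
    by (intro AE_all_countable[THEN iffD2] allI birkhoff_upper f) simp
  moreover have "AE x in M. \<forall>m::nat. \<forall>\<^sub>F n in sequentially.
           (\<Sum>i<n. - f ((T ^^ i) x)) / real n \<le> (\<integral>x. - f x \<partial>M) + inverse (Suc m)"
    using f by (intro AE_all_countable[THEN iffD2] allI birkhoff_upper) auto
  ultimately show ?thesis
  proof eventually_elim
    case (elim x)
    let ?A = "\<lambda>n. (\<Sum>i<n. f ((T ^^ i) x)) / real n"
    show ?case
    proof (rule tendstoI)
      fix e :: real assume "e > 0"
      then obtain m where m: "inverse (real (Suc m)) < e" using reals_Archimedean by blast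
      from elim(1)[rule_format, of m] elim(2)[rule_format, of m]
      show "\<forall>\<^sub>F n in sequentially. dist (?A n) (\<integral>x. f x \<partial>M) < e"
      proof eventually_elim
        case (elim n)
        then show ?case using m by (simp add: sum_negf dist_real_def)
      qed
    qed
  qed
qed

text \<open>Starting the orbit at \<open>n = 1\<close> replaces \<open>f\<close> by its composition
  with \<open>T\<close>, which has the same integral.\<close>

lemma birkhoff_shifted:
  fixes f :: "'a \<Rightarrow> real"
  assumes f: "integrable M f"
  shows "AE x in M. (\<lambda>K. (\<Sum>n=1..K. f ((T ^^ n) x)) / real K) \<longlonglongrightarrow> (\<integral>x. f x \<partial>M)"
proof -
  have "(\<Sum>n=1..K. f ((T ^^ n) x)) = (\<Sum>i<K. f (T ((T ^^ i) x)))" for K x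
    by (induction K) simp_all
  then show ?thesis
    using birkhoff_real[OF integrable_T[OF f]] integral_T[OF f] by simp
qed

lemma birkhoff_complex:
  fixes f :: "'a \<Rightarrow> complex"
  assumes f: "integrable M f"
  shows "AE x in M. (\<lambda>K. (\<Sum>n=1..K. f ((T ^^ n) x)) / of_nat K) \<longlonglongrightarrow> (\<integral>x. f x \<partial>M)"
  using birkhoff_shifted[OF integrable_Re[OF f]] birkhoff_shifted[OF integrable_Im[OF f]]
proof eventually_elim
  case (elim x)
  then show ?case
    using f by (simp add: tendsto_complex_iff integral_Re integral_Im Re_divide_of_nat Im_divide_of_nat)
qed

end

section \<open>Moments of the prime divisor functions\<close>

lemma prime_Omega_mult: "m \<noteq> 0 \<Longrightarrow> n \<noteq> 0 \<Longrightarrow> prime_Omega (m * n) = prime_Omega m + prime_Omega n"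
  by (simp add: prime_Omega_def prime_factorization_mult)

lemma prime_Omega_eq_sum: "prime_Omega n = (\<Sum>p\<in>prime_factors n. count (prime_factorization n) p)"
  by (simp add: prime_Omega_def size_multiset_overloaded_eq)

lemma prime_omega_le_Omega: "prime_omega n \<le> prime_Omega n"
proof -
  have "(\<Sum>p\<in>prime_factors n. 1) \<le> (\<Sum>p\<in>prime_factors n. count (prime_factorization n) p)"
    by (intro sum_mono) (simp add: Suc_le_eq)
  then show ?thesis by (simp add: prime_omega_def prime_Omega_eq_sum)
qed

lemma prime_Omega_squarefree:
  assumes "squarefree n"
  shows "prime_Omega n = prime_omega n"
proof -
  have "n \<noteq> 0" using assms by (metis not_squarefree_0)
  then have "count (prime_factorization n) p = 1" if "p \<in> prime_factors n" for p
    using assms that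
    by (auto simp: squarefree_factorial_semiring' count_prime_factorization_prime in_prime_factors_imp_prime)
  then show ?thesis by (simp add: prime_omega_def prime_Omega_eq_sum)
qed

lemma two_power_prime_Omega_le:
  assumes "n > 0"
  shows "2 ^ prime_Omega n \<le> n"
proof -
  have "2 ^ size A \<le> prod_mset A" if "\<forall>p\<in>#A. p \<ge> 2" for A :: "nat multiset"
    using that by (induction A) (auto intro: mult_mono)
  from this[of "prime_factorization n"] show ?thesis
    using assms by (auto simp: prime_Omega_def prime_ge_2_nat in_prime_factors_imp_prime prod_mset_prime_factorization_nat)
qed

lemma prod_prime_factors_squarefree:
  fixes n :: nat
  assumes "squarefree n"
  shows "\<Prod>(prime_factors n) = n"
proof -
  have "n \<noteq> 0" using assms by (metis not_squarefree_0)
  then have "n = (\<Prod>p\<in>prime_factors n. p ^ multiplicity p n)"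
    by (simp add: prime_factorization_nat)
  also have "\<dots> = \<Prod>(prime_factors n)"
    using assms \<open>n \<noteq> 0\<close> by (intro prod.cong) (auto simp: squarefree_factorial_semiring')
  finally show ?thesis by simp
qed

lemma prime_factors_prod_primes:
  fixes S :: "nat set"
  assumes "finite S" "\<And>p. p \<in> S \<Longrightarrow> prime p"
  shows "prime_factors (\<Prod>S) = S"
proof -
  have "\<Prod>S \<noteq> 0" using assms by (auto dest: assms(2))
  then have "prime_factors (\<Prod>S) = {p. prime p \<and> p dvd \<Prod>S}"
    by (rule prime_factors_dvd)
  also have "\<dots> = {p. prime p \<and> (\<exists>q\<in>S. p dvd q)}"
    using assms(1) by (simp add: prime_dvd_prod_iff cong: conj_cong)
  also have "\<dots> = S"
  proof safe
    fix p q assume "prime p" "q \<in> S" "p dvd q"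
    then show "p \<in> S" using assms(2)[of q] primes_dvd_imp_eq[of p q] by simp
  next
    fix p assume "p \<in> S"
    then show "prime p" "\<exists>q\<in>S. p dvd q" using assms(2)[of p] by (auto intro: dvd_refl)
  qed
  finally show ?thesis .
qed

text \<open>Distinct subsets of the prime factors have distinct products, and each product divides
  \<open>n\<close>.\<close>

lemma two_power_prime_Omega_squarefree_le:
  assumes "squarefree n"
  shows "2 ^ prime_Omega n \<le> card {d. d dvd n}"
proof -
  have "n \<noteq> 0" using assms by (metis not_squarefree_0)
  have "inj_on \<Prod> (Pow (prime_factors n))"
  proof (rule inj_on_inverseI)
    fix S assume "S \<in> Pow (prime_factors n)"
    then show "prime_factors (\<Prod>S) = S"
      by (intro prime_factors_prod_primes) (auto intro: finite_subset dest: in_prime_factors_imp_prime)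
  qed
  moreover have "\<Prod> ` Pow (prime_factors n) \<subseteq> {d. d dvd n}"
  proof safe
    fix S assume "S \<subseteq> prime_factors n"
    then have "\<Prod>S dvd \<Prod>(prime_factors n)" by (intro prod_dvd_prod_subset) auto
    then show "\<Prod>S dvd n" using prod_prime_factors_squarefree[OF assms] by simp
  qed
  ultimately have "card (Pow (prime_factors n)) \<le> card {d. d dvd n}"
    using \<open>n \<noteq> 0\<close> by (intro card_inj_on_le) auto
  then show ?thesis
    by (simp add: card_Pow prime_Omega_squarefree[OF assms] prime_omega_def)
qed

text \<open>The pair \<open>(square_part n, squarefree_part n)\<close> determines \<open>n\<close>
  and lies in the region summed over on the right. As \<open>F\<close> is nonnegative, pairs outside
  the image may be added. The lemma serves for the harmonic sum, for the exponential moment and for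
  the excess of \<open>prime_Omega\<close> over \<open>prime_omega\<close>.\<close>

lemma sum_square_decomposition_le:
  fixes F :: "nat \<Rightarrow> nat \<Rightarrow> real"
  assumes nonneg: "\<And>b m. F b m \<ge> 0"
  shows "(\<Sum>n=1..K. F (squarefree_part n) (square_part n))
           \<le> (\<Sum>m=1..K. \<Sum>b | b \<in> {1..K div m\<^sup>2} \<and> squarefree b. F b m)"
proof -
  let ?h = "\<lambda>n::nat. (square_part n, squarefree_part n)"
  let ?S = "Sigma {1..K} (\<lambda>m. {b \<in> {1..K div m\<^sup>2}. squarefree b})"
  have inj: "inj_on ?h {1..K}"
    by (rule inj_on_inverseI[where g = "\<lambda>(m, b). b * m\<^sup>2"]) (simp add: squarefree_decompose[symmetric])
  have "?h ` {1..K} \<subseteq> ?S"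
  proof safe
    fix n assume n: "n \<in> {1..K}"
    define m b where "m = square_part n" and "b = squarefree_part n"
    have eq: "n = b * m\<^sup>2" unfolding m_def b_def by (rule squarefree_decompose)
    have pos: "m > 0" "b > 0" using n eq by (auto intro!: Nat.gr0I)
    have "m \<le> m\<^sup>2" using pos by (simp add: power2_eq_square)
    also have "\<dots> \<le> n" using eq pos by simp
    finally show "square_part n \<in> {1..K}" using n pos by (simp add: m_def)
    have "b = n div m\<^sup>2" using eq pos by simp
    also have "\<dots> \<le> K div m\<^sup>2" using n by (intro div_le_mono) simp
    finally show "squarefree_part n \<in> {1..K div (square_part n)\<^sup>2}"
      using pos by (simp add: m_def b_def)
  qed auto
  moreover have "finite ?S" by (intro finite_SigmaI) auto
  ultimately have "(\<Sum>(m, b)\<in>?h ` {1..K}. F b m) \<le> (\<Sum>(m, b)\<in>?S. F b m)"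
    by (intro sum_mono2) (auto simp: nonneg)
  moreover have "(\<Sum>(m, b)\<in>?h ` {1..K}. F b m) = (\<Sum>n=1..K. F (squarefree_part n) (square_part n))"
    by (subst sum.reindex[OF inj]) simp
  ultimately have "(\<Sum>n=1..K. F (squarefree_part n) (square_part n)) \<le> (\<Sum>(m, b)\<in>?S. F b m)"
    by simp
  also have "\<dots> = (\<Sum>m=1..K. \<Sum>b | b \<in> {1..K div m\<^sup>2} \<and> squarefree b. F b m)"
    by (subst sum.Sigma) auto
  finally show ?thesis .
qed

section \<open>Divergence of the sum of the reciprocals of the primes\<close>

definition prime_recip_sum :: "nat \<Rightarrow> real" where
  "prime_recip_sum K = (\<Sum>p | prime p \<and> p \<le> K. 1 / real p)"

lemma finite_primes_le [simp]: "finite {p::nat. prime p \<and> p \<le> K}"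
  by (rule finite_subset[of _ "{..K}"]) auto

lemma prime_recip_sum_nonneg: "prime_recip_sum K \<ge> 0"
  by (simp add: prime_recip_sum_def sum_nonneg)

lemma prime_recip_sum_mono: "K \<le> K' \<Longrightarrow> prime_recip_sum K \<le> prime_recip_sum K'"
  unfolding prime_recip_sum_def by (intro sum_mono2) auto

lemma sum_inverse_squares_le: "(\<Sum>m=1..K. 1 / (real m)\<^sup>2) \<le> 2"
proof -
  \<comment> \<open>The term \<open>1 / K\<close> lets the induction telescope, since the next
    summand is at most \<open>1 / K - 1 / (K + 1)\<close>.\<close>
  have "(\<Sum>m=1..K. 1 / (real m)\<^sup>2) \<le> 2 - 1 / real K" if "K \<ge> 1" for K
    using that
  proof (induction K rule: dec_induct)
    case (step K)
    have "1 / (real (Suc K))\<^sup>2 \<le> 1 / real K - 1 / real (Suc K)"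
    proof -
      have "1 / (real (Suc K))\<^sup>2 \<le> 1 / (real K * real (Suc K))"
        using step by (intro divide_left_mono) (auto simp: power2_eq_square)
      also have "\<dots> = 1 / real K - 1 / real (Suc K)"
        using step by (simp add: field_simps)
      finally show ?thesis .
    qed
    then show ?case using step by simp
  qed simp
  from this[of K] show ?thesis by (cases "K = 0") (auto intro: order_trans)
qed

text \<open>Expanding the product of \<open>1 + 1 / p\<close> over the primes
  \<open>p \<le> K\<close> produces the reciprocal of every squarefree \<open>b \<le> K\<close>.
  Each factor is at most \<open>exp (1 / p)\<close>.\<close>

lemma sum_squarefree_recip_le:
  "(\<Sum>b | b \<in> {1..K} \<and> squarefree b. 1 / real b) \<le> exp (prime_recip_sum K)"
proof -
  let ?P = "{p. prime p \<and> p \<le> K}"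
  let ?B = "{b \<in> {1..K}. squarefree b}"
  have "(\<Sum>b\<in>?B. 1 / real b) = (\<Sum>b\<in>?B. \<Prod>p\<in>prime_factors b. 1 / real p)"
  proof (intro sum.cong refl)
    fix b assume "b \<in> ?B"
    then have eq: "\<Prod>(prime_factors b) = b" using prod_prime_factors_squarefree by simp
    have "(\<Prod>p\<in>prime_factors b. 1 / real p) = 1 / real (\<Prod>(prime_factors b))"
      by (simp add: prod_dividef)
    then show "1 / real b = (\<Prod>p\<in>prime_factors b. 1 / real p)"
      by (simp only: eq)
  qed
  also have "\<dots> = (\<Sum>S\<in>prime_factors ` ?B. \<Prod>p\<in>S. 1 / real p)"
  proof (subst sum.reindex)
    show "inj_on prime_factors ?B"
      by (rule inj_on_inverseI[where g = \<Prod>]) (simp add: prod_prime_factors_squarefree)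
  qed simp
  also have "\<dots> \<le> (\<Sum>S\<in>Pow ?P. \<Prod>p\<in>S. 1 / real p)"
  proof (rule sum_mono2)
    show "prime_factors ` ?B \<subseteq> Pow ?P"
      by (auto simp: prime_factors_dvd dest: dvd_imp_le)
  qed (auto intro: prod_nonneg)
  also have "\<dots> = (\<Prod>p\<in>?P. 1 / real p + 1)"
    by (subst prod_add) auto
  also have "\<dots> \<le> (\<Prod>p\<in>?P. exp (1 / real p))"
    by (intro prod_mono) (auto simp: add.commute intro: exp_ge_add_one_self add_nonneg_nonneg)
  also have "\<dots> = exp (prime_recip_sum K)"
    by (simp add: exp_sum prime_recip_sum_def)
  finally show ?thesis .
qed

text \<open>Erdos: writing \<open>n = b m\<^sup>2\<close> with \<open>b\<close> squarefree bounds the harmonic sum by the product of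
  the two preceding sums.\<close>
lemma ln_le_exp_prime_recip_sum:
  assumes "K \<ge> 1"
  shows "ln (real K) \<le> 2 * exp (prime_recip_sum K)"
proof -
  have "ln (real K) \<le> harm K"
    using ln_le_harm[of K] assms by (smt (verit) ln_mono of_nat_0_less_iff zero_less_one less_le_trans)
  also have "harm K = (\<Sum>n=1..K. 1 / (real (squarefree_part n) * (real (square_part n))\<^sup>2))"
    unfolding harm_def
  proof (intro sum.cong refl)
    fix n
    have "real n = real (squarefree_part n * (square_part n)\<^sup>2)"
      by (simp flip: squarefree_decompose)
    then show "inverse (of_nat n) = 1 / (real (squarefree_part n) * (real (square_part n))\<^sup>2)"
      by (simp add: inverse_eq_divide)
  qed
  also have "\<dots> \<le> (\<Sum>m=1..K. \<Sum>b | b \<in> {1..K div m\<^sup>2} \<and> squarefree b. 1 / (real b * (real m)\<^sup>2))"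
    by (rule sum_square_decomposition_le[where F = "\<lambda>b m. 1 / (real b * (real m)\<^sup>2)"]) simp
  also have "\<dots> \<le> (\<Sum>m=1..K. \<Sum>b | b \<in> {1..K} \<and> squarefree b. 1 / (real b * (real m)\<^sup>2))"
    by (intro sum_mono sum_mono2) (auto intro: order_trans[OF _ div_le_dividend])
  also have "\<dots> = (\<Sum>b | b \<in> {1..K} \<and> squarefree b. 1 / real b) * (\<Sum>m=1..K. 1 / (real m)\<^sup>2)"
    by (subst sum.swap) (simp add: sum_product)
  also have "\<dots> \<le> exp (prime_recip_sum K) * 2"
    by (intro mult_mono sum_squarefree_recip_le sum_inverse_squares_le) (auto intro: sum_nonneg)
  finally show ?thesis by simp
qed

lemma prime_recip_sum_at_top: "filterlim prime_recip_sum at_top sequentially"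
proof (rule filterlim_at_top_mono)
  have "filterlim (\<lambda>K. 1 / 2 * ln (real K)) at_top sequentially"
    by (intro filterlim_tendsto_pos_mult_at_top[OF tendsto_const]
        filterlim_compose[OF ln_at_top filterlim_real_sequentially]) simp
  from filterlim_compose[OF ln_at_top this]
  show "filterlim (\<lambda>K. ln (ln (real K) / 2)) at_top sequentially"
    by simp
  show "\<forall>\<^sub>F K in sequentially. ln (ln (real K) / 2) \<le> prime_recip_sum K"
    using eventually_ge_at_top[of 2]
  proof eventually_elim
    case (elim K)
    then have "0 < ln (real K) / 2" "ln (real K) / 2 \<le> exp (prime_recip_sum K)"
      using ln_le_exp_prime_recip_sum[of K] by auto
    then show ?case by (metis ln_exp ln_le_cancel_iff exp_gt_zero)
  qed
qed

section \<open>Turan's variance bound for \<open>prime_omega\<close>\<close>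

lemma card_multiples_le:
  assumes "d > 0"
  shows "card {n \<in> {1..K}. d dvd n} = K div d"
proof -
  have "bij_betw (\<lambda>k. d * k) {1..K div d} {n \<in> {1..K}. d dvd n}"
    using assms
    by (intro bij_betwI[where g = "\<lambda>n. n div d"])
       (auto simp: less_eq_div_iff_mult_less_eq mult.commute div_le_mono Suc_le_eq elim!: dvdE)
  then show ?thesis by (auto dest: bij_betw_same_card)
qed

lemma sum_of_bool_card: "finite A \<Longrightarrow> (\<Sum>x\<in>A. of_bool (P x)) = real (card {x \<in> A. P x})"
  by (simp add: sum_of_bool_eq Int_def)

lemma prime_omega_eq_sum:
  assumes "n \<in> {1..K}"
  shows "real (prime_omega n) = (\<Sum>p | prime p \<and> p \<le> K. of_bool (p dvd n))"
proof -
  have "{p \<in> {p. prime p \<and> p \<le> K}. p dvd n} = prime_factors n"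
    using assms by (auto simp: prime_factors_dvd dest: dvd_imp_le)
  then show ?thesis
    by (simp only: prime_omega_def sum_of_bool_card finite_primes_le)
qed

lemma sum_dvd: "d > 0 \<Longrightarrow> (\<Sum>n=1..K. of_bool (d dvd n)) = real (K div d)"
  by (simp only: sum_of_bool_card card_multiples_le finite_atLeastAtMost)

text \<open>Counting pairs of a prime and one of its multiples gives the sum of
  \<open>K div p\<close>. Dropping the rounding costs at most \<open>1\<close> for each of at most
  \<open>K\<close> primes.\<close>

lemma sum_prime_omega_ge:
  "(\<Sum>n=1..K. real (prime_omega n)) \<ge> real K * prime_recip_sum K - real K"
proof -
  let ?P = "{p. prime p \<and> p \<le> K}"
  have "?P \<subseteq> {1..K}" by (auto dest: prime_gt_0_nat)
  then have "card ?P \<le> K" using card_mono[of "{1..K}" ?P] by simp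
  have "real K * prime_recip_sum K - real K \<le> (\<Sum>p\<in>?P. real K / real p) - real (card ?P)"
    using \<open>card ?P \<le> K\<close> by (simp add: prime_recip_sum_def sum_distrib_left)
  also have "\<dots> = (\<Sum>p\<in>?P. real K / real p - 1)"
    by (simp add: sum_subtractf)
  also have "\<dots> \<le> (\<Sum>p\<in>?P. real (K div p))"
  proof (rule sum_mono)
    fix p
    show "real K / real p - 1 \<le> real (K div p)"
      using real_of_int_floor_ge_diff_one[of "real K / real p"] by (simp add: floor_divide_of_nat_eq)
  qed
  also have "\<dots> = (\<Sum>p\<in>?P. \<Sum>n=1..K. of_bool (p dvd n))"
    by (intro sum.cong refl sum_dvd[symmetric]) (auto dest: prime_gt_0_nat)
  also have "\<dots> = (\<Sum>n=1..K. real (prime_omega n))"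
    by (subst sum.swap) (intro sum.cong refl prime_omega_eq_sum[symmetric])
  finally show ?thesis .
qed

text \<open>The square counts pairs of primes dividing \<open>n\<close>. Two distinct primes divide
  \<open>n\<close> exactly when their product does, which yields \<open>K / (p * q)\<close>; the
  diagonal yields \<open>K / p\<close> and hence the linear term.\<close>

lemma sum_prime_omega_square_le:
  "(\<Sum>n=1..K. (real (prime_omega n))\<^sup>2) \<le> real K * ((prime_recip_sum K)\<^sup>2 + prime_recip_sum K)"
proof -
  let ?P = "{p. prime p \<and> p \<le> K}"
  have "(\<Sum>n=1..K. (real (prime_omega n))\<^sup>2)
      = (\<Sum>n=1..K. \<Sum>p\<in>?P. \<Sum>q\<in>?P. of_bool (p dvd n) * of_bool (q dvd n))"
    by (intro sum.cong refl) (simp only: prime_omega_eq_sum power2_eq_square sum_product)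
  also have "\<dots> = (\<Sum>p\<in>?P. \<Sum>q\<in>?P. \<Sum>n=1..K. of_bool (p dvd n) * of_bool (q dvd n))"
    by (subst sum.swap) (intro sum.cong refl sum.swap)
  also have "\<dots> \<le> (\<Sum>p\<in>?P. \<Sum>q\<in>?P. real K * (1 / real p * (1 / real q) + of_bool (p = q) * (1 / real p)))"
  proof (intro sum_mono)
    fix p q assume "p \<in> ?P" "q \<in> ?P"
    then have pq: "prime p" "prime q" "p > 0" "q > 0" by (auto dest: prime_gt_0_nat)
    have le: "real (K div d) \<le> real K * (1 / real d)" for d
      using of_nat_div_le_of_nat[where 'a=real, of K d] by simp
    show "(\<Sum>n=1..K. of_bool (p dvd n) * of_bool (q dvd n))
        \<le> real K * (1 / real p * (1 / real q) + of_bool (p = q) * (1 / real p))"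
    proof (cases "p = q")
      case True
      then have "(\<Sum>n=1..K. of_bool (p dvd n) * of_bool (q dvd n)) = real (K div p)"
        using sum_dvd[of p K] pq by (simp flip: of_bool_conj)
      also have "\<dots> \<le> real K * (1 / real p)" by (rule le)
      finally show ?thesis using True by (simp add: distrib_left add_increasing)
    next
      case False
      then have "coprime p q" using pq by (simp add: primes_coprime)
      then have "(\<Sum>n=1..K. of_bool (p dvd n) * of_bool (q dvd n)) = (\<Sum>n=1..K. of_bool (p * q dvd n) :: real)"
        by (intro sum.cong refl) (auto simp: divides_mult simp flip: of_bool_conj dest: dvd_mult_left dvd_mult_right)
      also have "\<dots> = real (K div (p * q))"
        using sum_dvd[of "p * q" K] pq by simp
      also have "\<dots> \<le> real K * (1 / real (p * q))" by (rule le)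
      finally show ?thesis using False by simp
    qed
  qed
  also have "\<dots> = real K * ((\<Sum>p\<in>?P. \<Sum>q\<in>?P. 1 / real p * (1 / real q)) + (\<Sum>p\<in>?P. \<Sum>q\<in>?P. of_bool (p = q) * (1 / real p)))"
    by (simp only: sum.distrib sum_distrib_left[symmetric])
  also have "(\<Sum>p\<in>?P. \<Sum>q\<in>?P. of_bool (p = q) * (1 / real p)) = prime_recip_sum K"
    unfolding prime_recip_sum_def
  proof (intro sum.cong refl)
    fix p assume "p \<in> ?P"
    moreover have "(\<Sum>q\<in>?P. of_bool (p = q) * (1 / real p)) = (\<Sum>q\<in>?P. if p = q then 1 / real p else 0)"
      by (intro sum.cong refl) simp
    ultimately show "(\<Sum>q\<in>?P. of_bool (p = q) * (1 / real p)) = 1 / real p"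
      by (simp only: sum.delta' finite_primes_le if_True)
  qed
  also have "(\<Sum>p\<in>?P. \<Sum>q\<in>?P. 1 / real p * (1 / real q)) = (prime_recip_sum K)\<^sup>2"
    by (simp add: prime_recip_sum_def power2_eq_square sum_product)
  finally show ?thesis .
qed

text \<open>When the square is expanded, the terms in \<open>(prime_recip_sum K)\<^sup>2\<close>
  cancel. One linear term remains from the second moment and two from the error in the first
  moment.\<close>

lemma turan_kubilius:
  "(\<Sum>n=1..K. (real (prime_omega n) - prime_recip_sum K)\<^sup>2) \<le> 3 * prime_recip_sum K * real K"
proof -
  let ?L = "prime_recip_sum K" and ?w = "\<lambda>n. real (prime_omega n)"
  have "(\<Sum>n=1..K. (?w n - ?L)\<^sup>2) = (\<Sum>n=1..K. (?w n)\<^sup>2 - 2 * ?L * ?w n + ?L\<^sup>2)"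
    by (intro sum.cong refl) (simp add: power2_eq_square algebra_simps)
  also have "\<dots> = (\<Sum>n=1..K. (?w n)\<^sup>2) - 2 * ?L * (\<Sum>n=1..K. ?w n) + real K * ?L\<^sup>2"
    by (simp add: sum.distrib sum_subtractf sum_distrib_left)
  also have "\<dots> \<le> real K * (?L\<^sup>2 + ?L) - 2 * ?L * (real K * ?L - real K) + real K * ?L\<^sup>2"
    using sum_prime_omega_square_le[of K]
      mult_left_mono[OF sum_prime_omega_ge[of K], of "2 * ?L"] prime_recip_sum_nonneg[of K] by simp
  also have "\<dots> = 3 * ?L * real K" by (simp add: algebra_simps power2_eq_square)
  finally show ?thesis .
qed

lemma sum_abs_prime_omega_diff_le:
  assumes "prime_recip_sum K > 0"
  shows "(\<Sum>n=1..K. \<bar>real (prime_omega n) - prime_recip_sum K\<bar>) \<le> 4 * sqrt (prime_recip_sum K) * real K"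
proof -
  let ?L = "prime_recip_sum K"
  \<comment> \<open>This replaces Cauchy-Schwarz. The weight \<open>sqrt ?L\<close> balances the two
    terms: summed, they give \<open>3 * sqrt ?L * K\<close> and \<open>sqrt ?L * K\<close>.\<close>
  have abs_le: "\<bar>t\<bar> \<le> t\<^sup>2 / sqrt ?L + sqrt ?L" for t
  proof -
    have "0 \<le> (\<bar>t\<bar> - sqrt ?L)\<^sup>2 + \<bar>t\<bar> * sqrt ?L" using assms by simp
    also have "\<dots> = t\<^sup>2 + (sqrt ?L)\<^sup>2 - \<bar>t\<bar> * sqrt ?L"
      by (simp add: power2_eq_square algebra_simps)
    finally have "\<bar>t\<bar> * sqrt ?L \<le> t\<^sup>2 + (sqrt ?L)\<^sup>2" by simp
    then show ?thesis using assms by (simp add: field_simps power2_eq_square)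
  qed
  have "(\<Sum>n=1..K. \<bar>real (prime_omega n) - ?L\<bar>)
      \<le> (\<Sum>n=1..K. (real (prime_omega n) - ?L)\<^sup>2 / sqrt ?L + sqrt ?L)"
    by (intro sum_mono abs_le)
  also have "\<dots> = (\<Sum>n=1..K. (real (prime_omega n) - ?L)\<^sup>2) / sqrt ?L + real K * sqrt ?L"
    by (simp add: sum.distrib sum_divide_distrib)
  also have "\<dots> \<le> 3 * ?L * real K / sqrt ?L + real K * sqrt ?L"
    using turan_kubilius[of K] prime_recip_sum_nonneg[of K] by (intro add_mono divide_right_mono) auto
  also have "3 * ?L * real K / sqrt ?L = 3 * (?L / sqrt ?L) * real K" by simp
  also have "?L / sqrt ?L = sqrt ?L" using assms by (simp add: real_div_sqrt)
  finally show ?thesis by (simp add: algebra_simps)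
qed

section \<open>Exponential moment of \<open>prime_Omega\<close> and its excess over
  \<open>prime_omega\<close>\<close>

lemma exp_prime_Omega_le_sqrt:
  assumes "m > 0"
  shows "exp (ln 2 / 2 * real (prime_Omega m)) \<le> sqrt (real m)"
proof -
  have "exp (ln 2 / 2 * real (prime_Omega m)) ^ 2 = 2 ^ prime_Omega m"
    by (simp flip: exp_of_nat_mult) (simp add: mult.commute exp_of_nat_mult)
  also have "\<dots> \<le> real m"
    using two_power_prime_Omega_le[OF assms] by (metis of_nat_le_iff of_nat_numeral of_nat_power)
  finally show ?thesis by (intro real_le_rsqrt)
qed

lemma exp_prime_Omega_squarefree_le:
  assumes "squarefree b"
  shows "exp (ln 2 / 4 * real (prime_Omega b)) \<le> real (card {d. d dvd b})"
proof -
  have "exp (ln 2 / 4 * real (prime_Omega b)) \<le> exp (real (prime_Omega b) * ln 2)"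
    by simp
  also have "\<dots> = real (2 ^ prime_Omega b)"
    by (simp add: exp_of_nat_mult)
  also have "\<dots> \<le> real (card {d. d dvd b})"
    using two_power_prime_Omega_squarefree_le[OF assms] by (simp only: of_nat_le_iff)
  finally show ?thesis .
qed

lemma prime_Omega_square_decomposition:
  assumes "n > 0"
  shows "prime_Omega n = prime_Omega (squarefree_part n) + 2 * prime_Omega (square_part n)"
proof -
  have "prime_Omega (squarefree_part n * (square_part n)\<^sup>2)
      = prime_Omega (squarefree_part n) + 2 * prime_Omega (square_part n)"
    using assms by (simp add: power2_eq_square prime_Omega_mult)
  then show ?thesis by (simp flip: squarefree_decompose)
qed

text \<open>Exchanging the sums counts the multiples of each \<open>d\<close>, which gives at most
  \<open>Y\<close> times the harmonic sum.\<close>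

lemma sum_count_divisors_le:
  "(\<Sum>b=1..Y. real (card {d. d dvd b})) \<le> real Y * (1 + ln (real Y))"
proof (cases "Y = 0")
  case False
  have "(\<Sum>b=1..Y. real (card {d. d dvd b})) = (\<Sum>b=1..Y. \<Sum>d=1..Y. of_bool (d dvd b))"
  proof (intro sum.cong refl)
    fix b assume "b \<in> {1..Y}"
    then have "{d \<in> {1..Y}. d dvd b} = {d. d dvd b}"
      by (auto dest: dvd_imp_le intro: Nat.gr0I)
    then show "real (card {d. d dvd b}) = (\<Sum>d=1..Y. of_bool (d dvd b))"
      by (simp only: sum_of_bool_card finite_atLeastAtMost)
  qed
  also have "\<dots> = (\<Sum>d=1..Y. real (Y div d))"
    by (subst sum.swap) (intro sum.cong refl sum_dvd, simp)
  also have "\<dots> \<le> (\<Sum>d=1..Y. real Y * inverse (real d))"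
    by (intro sum_mono) (use of_nat_div_le_of_nat[where 'a=real, of Y] in \<open>simp add: divide_inverse\<close>)
  also have "\<dots> = real Y * harm Y"
    by (simp add: harm_def sum_distrib_left)
  also have "\<dots> \<le> real Y * (1 + ln (real Y))"
    using euler_mascheroni_sequence_decreasing[of 1 Y] False by (intro mult_left_mono) (auto simp: harm_def)
  finally show ?thesis .
qed simp

text \<open>This is \<zeta>(3/2); the term at \<open>m = 0\<close> vanishes because
  \<open>0 powr a = 0\<close>.\<close>

definition zeta_const :: real where
  "zeta_const = (\<Sum>m. real m powr (-3/2))"

lemma sum_sqrt_div_square_le: "(\<Sum>m=1..K. sqrt (real m) / (real m)\<^sup>2) \<le> zeta_const"
proof -
  have "(\<Sum>m=1..K. sqrt (real m) / (real m)\<^sup>2) = (\<Sum>m=1..K. real m powr (-3/2))"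
  proof (intro sum.cong refl)
    fix m assume "m \<in> {1..K}"
    then have m: "real m > 0" by simp
    have "real m powr (1/2 - 2) = real m powr (1/2) / real m powr 2"
      by (rule powr_diff)
    then show "sqrt (real m) / (real m)\<^sup>2 = real m powr (-3/2)"
      using m by (simp add: powr_half_sqrt)
  qed
  also have "\<dots> \<le> zeta_const"
    unfolding zeta_const_def by (intro sum_le_suminf) (auto simp: summable_real_powr_iff)
  finally show ?thesis .
qed

text \<open>For \<open>n = b * m^2\<close> with \<open>b\<close> squarefree, \<open>b\<close>
  contributes at most its number of divisors. The square counts \<open>prime_Omega m\<close> twice,
  so the rate \<open>ln 2 / 4\<close> becomes \<open>ln 2 / 2\<close> and \<open>m\<close>
  contributes at most \<open>sqrt m\<close>. Summing the divisor counts over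
  \<open>b \<le> K / m^2\<close> leaves the convergent series of
  \<open>sqrt m / m^2\<close>.\<close>

lemma sum_exp_prime_Omega_le:
  "(\<Sum>n=1..K. exp (ln 2 / 4 * real (prime_Omega n))) \<le> zeta_const * real K * (1 + ln (real K))"
proof -
  have "(\<Sum>n=1..K. exp (ln 2 / 4 * real (prime_Omega n)))
      \<le> (\<Sum>n=1..K. real (card {d. d dvd squarefree_part n}) * sqrt (real (square_part n)))"
  proof (rule sum_mono)
    fix n assume "n \<in> {1..K}"
    then have "n > 0" by simp
    then have "exp (ln 2 / 4 * real (prime_Omega n))
        = exp (ln 2 / 4 * real (prime_Omega (squarefree_part n))) * exp (ln 2 / 2 * real (prime_Omega (square_part n)))"
      by (simp add: prime_Omega_square_decomposition[of n] algebra_simps flip: exp_add)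
    also have "\<dots> \<le> real (card {d. d dvd squarefree_part n}) * sqrt (real (square_part n))"
      using \<open>n > 0\<close>
      by (intro mult_mono exp_prime_Omega_squarefree_le exp_prime_Omega_le_sqrt squarefree_squarefree_part)
         (auto intro: Nat.gr0I)
    finally show "exp (ln 2 / 4 * real (prime_Omega n))
        \<le> real (card {d. d dvd squarefree_part n}) * sqrt (real (square_part n))" .
  qed
  also have "\<dots> \<le> (\<Sum>m=1..K. \<Sum>b | b \<in> {1..K div m\<^sup>2} \<and> squarefree b. real (card {d. d dvd b}) * sqrt (real m))"
    by (rule sum_square_decomposition_le[where F = "\<lambda>b m. real (card {d. d dvd b}) * sqrt (real m)"]) simp
  also have "\<dots> \<le> (\<Sum>m=1..K. \<Sum>b=1..K div m\<^sup>2. real (card {d. d dvd b}) * sqrt (real m))"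
    by (intro sum_mono sum_mono2) auto
  also have "\<dots> \<le> (\<Sum>m=1..K. sqrt (real m) / (real m)\<^sup>2 * (real K * (1 + ln (real K))))"
  proof (rule sum_mono)
    fix m assume m: "m \<in> {1..K}"
    define Y where "Y = K div m\<^sup>2"
    have Y: "real Y \<le> real K / (real m)\<^sup>2"
      unfolding Y_def using of_nat_div_le_of_nat[where 'a=real, of K "m\<^sup>2"] by simp
    have "Y \<le> K" by (simp add: Y_def)
    then have ln: "real Y * (1 + ln (real Y)) \<le> real K / (real m)\<^sup>2 * (1 + ln (real K))"
    \<comment> \<open>The quotient \<open>Y\<close> is \<open>0\<close> once \<open>m^2 > K\<close>;
      comparing logarithms requires it to be positive.\<close>
    proof (cases "Y = 0")
      case False
      with \<open>Y \<le> K\<close> have "0 \<le> ln (real Y)" "ln (real Y) \<le> ln (real K)" by auto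
      then show ?thesis using Y by (intro mult_mono) auto
    qed (use m in auto)
    have "(\<Sum>b=1..Y. real (card {d. d dvd b}) * sqrt (real m))
        \<le> real K / (real m)\<^sup>2 * (1 + ln (real K)) * sqrt (real m)"
      unfolding sum_distrib_right[symmetric]
      by (intro mult_right_mono order_trans[OF sum_count_divisors_le ln]) simp
    then show "(\<Sum>b=1..K div m\<^sup>2. real (card {d. d dvd b}) * sqrt (real m))
        \<le> sqrt (real m) / (real m)\<^sup>2 * (real K * (1 + ln (real K)))"
      by (simp add: Y_def mult_ac)
  qed
  also have "\<dots> = (\<Sum>m=1..K. sqrt (real m) / (real m)\<^sup>2) * (real K * (1 + ln (real K)))"
    by (simp only: sum_distrib_right)
  also have "\<dots> \<le> zeta_const * (real K * (1 + ln (real K)))"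
    by (intro mult_right_mono sum_sqrt_div_square_le) (cases "K = 0"; simp)
  finally show ?thesis by simp
qed

lemma le_exp_div:
  fixes c :: real
  assumes "c > 0"
  shows "t \<le> exp (c * t) / c"
proof -
  have "c * t \<le> exp (c * t)" using exp_ge_add_one_self[of "c * t"] by linarith
  then show ?thesis using assms by (simp add: field_simps)
qed

text \<open>The prime factors of the squarefree part already occur in \<open>prime_omega n\<close>,
  so only the square part contributes to the excess, and it does so by a multiple of
  \<open>sqrt m\<close>. The resulting bound is linear in \<open>K\<close>, hence negligible against
  \<open>K * prime_recip_sum K\<close>.\<close>

lemma sum_prime_Omega_diff_omega_le:
  "(\<Sum>n=1..K. real (prime_Omega n) - real (prime_omega n)) \<le> 4 / ln 2 * zeta_const * real K"
proof -
  have "(\<Sum>n=1..K. real (prime_Omega n) - real (prime_omega n))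
      \<le> (\<Sum>n=1..K. 4 / ln 2 * sqrt (real (square_part n)))"
  proof (rule sum_mono)
    fix n assume n: "n \<in> {1..K}"
    have "prime_factors (squarefree_part n) \<subseteq> prime_factors n"
      using n squarefree_decompose[of n] by (intro dvd_prime_factors) (auto intro: dvdI)
    then have "prime_Omega (squarefree_part n) \<le> prime_omega n"
      by (simp add: prime_Omega_squarefree[OF squarefree_squarefree_part] prime_omega_def card_mono)
    then have "real (prime_Omega n) - real (prime_omega n) \<le> 2 * real (prime_Omega (square_part n))"
      using prime_Omega_square_decomposition[of n] n by simp
    also have "\<dots> \<le> 2 * (exp (ln 2 / 2 * real (prime_Omega (square_part n))) / (ln 2 / 2))"
      by (intro mult_left_mono le_exp_div) auto
    also have "\<dots> = 4 / ln 2 * exp (ln 2 / 2 * real (prime_Omega (square_part n)))"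
      by simp
    also have "\<dots> \<le> 4 / ln 2 * sqrt (real (square_part n))"
      using n by (intro mult_left_mono exp_prime_Omega_le_sqrt) (auto intro: Nat.gr0I)
    finally show "real (prime_Omega n) - real (prime_omega n) \<le> 4 / ln 2 * sqrt (real (square_part n))" .
  qed
  also have "\<dots> \<le> (\<Sum>m=1..K. \<Sum>b | b \<in> {1..K div m\<^sup>2} \<and> squarefree b. 4 / ln 2 * sqrt (real m))"
    by (rule sum_square_decomposition_le[where F = "\<lambda>b m. 4 / ln 2 * sqrt (real m)"]) simp
  also have "\<dots> \<le> (\<Sum>m=1..K. \<Sum>b=1..K div m\<^sup>2. 4 / ln 2 * sqrt (real m))"
    by (intro sum_mono sum_mono2) auto
  also have "\<dots> \<le> (\<Sum>m=1..K. 4 / ln 2 * real K * (sqrt (real m) / (real m)\<^sup>2))"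
  proof (rule sum_mono)
    fix m
    have "real (K div m\<^sup>2) \<le> real K / (real m)\<^sup>2"
      using of_nat_div_le_of_nat[where 'a=real, of K "m\<^sup>2"] by simp
    then have "real (K div m\<^sup>2) * (4 / ln 2 * sqrt (real m)) \<le> real K / (real m)\<^sup>2 * (4 / ln 2 * sqrt (real m))"
      by (intro mult_right_mono) auto
    then show "(\<Sum>b=1..K div m\<^sup>2. 4 / ln 2 * sqrt (real m)) \<le> 4 / ln 2 * real K * (sqrt (real m) / (real m)\<^sup>2)"
      by (simp add: mult_ac)
  qed
  also have "\<dots> \<le> 4 / ln 2 * real K * zeta_const"
    unfolding sum_distrib_left[symmetric] by (intro mult_left_mono sum_sqrt_div_square_le) auto
  finally show ?thesis by (simp add: mult_ac)
qed

section \<open>Weighted averages\<close>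

lemma filterlim_floor_log: "filterlim floor_log at_top sequentially"
  unfolding filterlim_at_top
proof
  fix Z :: nat
  show "\<forall>\<^sub>F K in sequentially. Z \<le> floor_log K"
    using monoD[OF floor_log_mono, of "2 ^ Z"]
    by (intro eventually_sequentiallyI[of "2 ^ Z"]) simp
qed

text \<open>The part of \<open>a\<close> of norm at most \<open>m\<close> is controlled by
  \<open>mean\<close>. For the part above \<open>m\<close>, weights up to the cut cost at most the
  factor \<open>C + 1\<close> and \<open>small\<close> applies; weights beyond the cut are left to
  \<open>tail\<close>. The tail is indexed by dyadic scales, and \<open>K\<close> uses the scale
  \<open>k = floor_log K\<close>.\<close>

lemma weighted_average_diff_tendsto_0:
  fixes g L :: "nat \<Rightarrow> real" and a :: "nat \<Rightarrow> 'b::real_normed_vector"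
  assumes g: "\<And>n. g n \<ge> 0" and C: "C \<ge> 0"
    and L: "mono L" "filterlim L at_top sequentially"
    and mean: "(\<lambda>K. (\<Sum>n=1..K. \<bar>g n - L K\<bar>) / (real K * L K)) \<longlonglongrightarrow> 0"
    and tail: "(\<lambda>k. (\<Sum>n | n \<in> {1..2 ^ Suc k} \<and> g n > C * L (2 ^ k). g n * norm (a n)) / 2 ^ k) \<longlonglongrightarrow> 0"
    and small: "\<And>\<epsilon>. \<epsilon> > 0 \<Longrightarrow> \<exists>m \<rho>. \<rho> < \<epsilon> \<and>
      (\<lambda>K. (\<Sum>n=1..K. norm (a n) * of_bool (norm (a n) > m)) / real K) \<longlonglongrightarrow> \<rho>"
  shows "(\<lambda>K. (\<Sum>n=1..K. (g n - L K) *\<^sub>R a n) /\<^sub>R (real K * L K)) \<longlonglongrightarrow> 0"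
proof (rule tendstoI)
  fix \<epsilon> :: real assume "\<epsilon> > 0"
  then have "\<epsilon> / (C + 1) > 0" using C by simp
  then obtain m \<rho> where \<rho>: "\<rho> < \<epsilon> / (C + 1)"
    and lim: "(\<lambda>K. (\<Sum>n=1..K. norm (a n) * of_bool (norm (a n) > m)) / real K) \<longlonglongrightarrow> \<rho>"
    using small by blast
  define r where "r n = norm (a n) * of_bool (norm (a n) > m)" for n
  define V where "V K = (\<Sum>n=1..K. \<bar>g n - L K\<bar>) / (real K * L K)" for K
  define R where "R K = (\<Sum>n=1..K. r n) / real K" for K
  define big where "big k n \<longleftrightarrow> n \<in> {1..2 ^ Suc k} \<and> g n > C * L (2 ^ k)" for k n
  define B where "B k = (\<Sum>n | big k n. g n * norm (a n)) / 2 ^ k" for k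
  \<comment> \<open>The threshold \<open>m\<close> may be negative, hence the absolute value in the
    last bound.\<close>
  have r: "r n \<ge> 0" "r n \<le> norm (a n)" "norm (a n) \<le> \<bar>m\<bar> + r n" for n
    by (auto simp: r_def of_bool_def)
  have "V \<longlonglongrightarrow> 0" "R \<longlonglongrightarrow> \<rho>" "B \<longlonglongrightarrow> 0"
    using mean lim tail by (simp_all only: V_def[abs_def] R_def[abs_def] r_def[abs_def] B_def[abs_def] big_def[abs_def])
  then have "(\<lambda>K. \<bar>m\<bar> * V K + (C + 1) * R K + B (floor_log K)) \<longlonglongrightarrow> \<bar>m\<bar> * 0 + (C + 1) * \<rho> + 0"
    by (intro tendsto_intros filterlim_compose[OF _ filterlim_floor_log, of B])
  moreover have "\<bar>m\<bar> * 0 + (C + 1) * \<rho> + 0 < \<epsilon>"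
    using \<rho> C by (simp add: field_simps)
  ultimately have "\<forall>\<^sub>F K in sequentially. \<bar>m\<bar> * V K + (C + 1) * R K + B (floor_log K) < \<epsilon>"
    by (rule order_tendstoD(2))
  moreover have "\<forall>\<^sub>F K in sequentially. L K \<ge> 1"
    using L(2) by (simp add: filterlim_at_top)
  ultimately show "\<forall>\<^sub>F K in sequentially.
      dist ((\<Sum>n=1..K. (g n - L K) *\<^sub>R a n) /\<^sub>R (real K * L K)) 0 < \<epsilon>"
    using eventually_gt_at_top[of 0]
  proof eventually_elim
    case (elim K)
    define k where "k = floor_log K"
    have k: "2 ^ k \<le> K" "K \<le> 2 ^ Suc k"
      using floor_log_exp2_le[of K] floor_log_exp2_gt[of K] elim by (auto simp: k_def)
    have fin: "finite {n. big k n}"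
      by (rule finite_subset[of _ "{1..2 ^ Suc k}"]) (auto simp: big_def)
    have term_le: "\<bar>g n - L K\<bar> * norm (a n)
        \<le> \<bar>m\<bar> * \<bar>g n - L K\<bar> + (C + 1) * L K * r n + of_bool (big k n) * (g n * norm (a n))"
      if n: "n \<in> {1..K}" for n
    proof -
      have "g n * r n \<le> C * L K * r n + of_bool (big k n) * (g n * norm (a n))"
      proof (cases "big k n")
        case True
        have "g n * r n \<le> g n * norm (a n)" using g r by (intro mult_left_mono) auto
        moreover have "0 \<le> C * L K * r n" using C r elim by simp
        ultimately show ?thesis using True by simp
      next
        case False
        then have "g n \<le> C * L (2 ^ k)" using n k by (auto simp: big_def)
        \<comment> \<open>The cut is fixed on each dyadic block; monotonicity of \<open>L\<close>
          passes from \<open>2 ^ k\<close> to \<open>K\<close>.\<close>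
        also have "\<dots> \<le> C * L K" using monoD[OF L(1) k(1)] C by (rule mult_left_mono)
        finally show ?thesis using False r by (simp add: mult_right_mono)
      qed
      moreover have "\<bar>g n - L K\<bar> * r n \<le> (g n + L K) * r n"
        using g[of n] elim r by (intro mult_right_mono) auto
      moreover have "\<bar>g n - L K\<bar> * norm (a n) \<le> \<bar>g n - L K\<bar> * (\<bar>m\<bar> + r n)"
        using r by (intro mult_left_mono) auto
      ultimately show ?thesis by (simp add: algebra_simps)
    qed
    have "(\<Sum>n=1..K. of_bool (big k n) * (g n * norm (a n))) \<le> (\<Sum>n | big k n. g n * norm (a n))"
    proof -
      have "(\<Sum>n=1..K. of_bool (big k n) * (g n * norm (a n))) = (\<Sum>n\<in>{1..K} \<inter> {n. big k n}. g n * norm (a n))"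
        unfolding sum.inter_restrict[OF finite_atLeastAtMost] by (intro sum.cong refl) simp
      also have "\<dots> \<le> (\<Sum>n | big k n. g n * norm (a n))"
        using fin g by (intro sum_mono2) auto
      finally show ?thesis .
    qed
    also have "\<dots> = 2 ^ k * B k" by (simp add: B_def)
    \<comment> \<open>\<open>B k\<close> is normalized by \<open>2 ^ k\<close> alone, so this uses
      \<open>L K \<ge> 1\<close> besides \<open>2 ^ k \<le> K\<close>.\<close>
    also have "\<dots> \<le> (real K * L K) * B k"
    proof (rule mult_right_mono)
      have "real (2 ^ k) \<le> real K" using k(1) by (simp only: of_nat_le_iff)
      then have "2 ^ k * 1 \<le> real K * L K"
        using elim by (intro mult_mono) auto
      then show "2 ^ k \<le> real K * L K" by simp
      show "0 \<le> B k" using g by (auto simp: B_def intro!: divide_nonneg_nonneg sum_nonneg)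
    qed
    finally have big_le: "(\<Sum>n=1..K. of_bool (big k n) * (g n * norm (a n))) \<le> (real K * L K) * B k" .
    have "norm (\<Sum>n=1..K. (g n - L K) *\<^sub>R a n) \<le> (\<Sum>n=1..K. \<bar>g n - L K\<bar> * norm (a n))"
      by (rule order_trans[OF norm_sum]) simp
    also have "\<dots> \<le> (\<Sum>n=1..K. \<bar>m\<bar> * \<bar>g n - L K\<bar> + (C + 1) * L K * r n + of_bool (big k n) * (g n * norm (a n)))"
      by (intro sum_mono term_le)
    also have "\<dots> = \<bar>m\<bar> * (\<Sum>n=1..K. \<bar>g n - L K\<bar>) + (C + 1) * L K * (\<Sum>n=1..K. r n)
        + (\<Sum>n=1..K. of_bool (big k n) * (g n * norm (a n)))"
      by (simp only: sum.distrib sum_distrib_left)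
    also have "\<dots> \<le> \<bar>m\<bar> * (real K * L K * V K) + (C + 1) * L K * (real K * R K) + (real K * L K) * B k"
      using big_le elim by (intro add_mono) (simp_all add: V_def R_def)
    also have "\<dots> = (real K * L K) * (\<bar>m\<bar> * V K + (C + 1) * R K + B k)"
      by (simp add: algebra_simps)
    also have "\<dots> < (real K * L K) * \<epsilon>"
      using elim by (intro mult_strict_left_mono) (auto simp: k_def)
    finally have "norm (\<Sum>n=1..K. (g n - L K) *\<^sub>R a n) < \<epsilon> * (real K * L K)"
      by (simp only: mult.commute)
    moreover have "real K * L K > 0" using elim by simp
    moreover from this have "dist ((\<Sum>n=1..K. (g n - L K) *\<^sub>R a n) /\<^sub>R (real K * L K)) 0
        = norm (\<Sum>n=1..K. (g n - L K) *\<^sub>R a n) / (real K * L K)"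
      by (simp only: dist_0_norm dist_commute[of _ 0] norm_scaleR abs_inverse abs_of_pos divide_inverse mult.commute)
    ultimately show ?case
      by (simp only: pos_divide_less_eq)
  qed
qed

context ergodic_system
begin

section \<open>Almost everywhere statements along orbits\<close>

text \<open>By invariance, the integral of the \<open>k\<close>-th sum is its total weight times the
  \<open>L1\<close> norm of \<open>f\<close>. These integrals are summable, so the series over
  \<open>k\<close> is finite almost everywhere and its terms tend to \<open>0\<close>.\<close>

lemma AE_tail_tendsto_0:
  fixes f :: "'a \<Rightarrow> 'b::{banach, second_countable_topology}" and w :: "nat \<Rightarrow> nat \<Rightarrow> real"
  assumes f: "integrable M f"
    and w: "\<And>k n. w k n \<ge> 0" and I: "\<And>k. finite (I k)"
    and summable: "summable (\<lambda>k. \<Sum>n\<in>I k. w k n)"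
  shows "AE x in M. (\<lambda>k. \<Sum>n\<in>I k. w k n * norm (f ((T ^^ n) x))) \<longlonglongrightarrow> 0"
proof -
  let ?B = "\<lambda>k x. \<Sum>n\<in>I k. w k n * norm (f ((T ^^ n) x))"
  have int: "integrable M (?B k)" for k
    using integrable_T_funpow[OF f] by (intro Bochner_Integration.integrable_sum integrable_mult_right integrable_norm)
  have B0: "?B k x \<ge> 0" for k x using w by (intro sum_nonneg mult_nonneg_nonneg) auto
  have eq: "(\<integral>x. ?B k x \<partial>M) = (\<Sum>n\<in>I k. w k n) * (\<integral>x. norm (f x) \<partial>M)" for k
  proof -
    have "(\<integral>x. ?B k x \<partial>M) = (\<Sum>n\<in>I k. w k n * (\<integral>x. norm (f ((T ^^ n) x)) \<partial>M))"
      using integrable_T_funpow[OF f] by (subst Bochner_Integration.integral_sum) auto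
    then show ?thesis
      using integral_T_funpow[OF integrable_norm[OF f]] by (simp add: sum_distrib_right)
  qed
  have "(\<integral>\<^sup>+x. (\<Sum>k. ennreal (?B k x)) \<partial>M) = (\<Sum>k. \<integral>\<^sup>+x. ennreal (?B k x) \<partial>M)"
    using int by (intro nn_integral_suminf) auto
  also have "\<dots> = (\<Sum>k. ennreal ((\<Sum>n\<in>I k. w k n) * (\<integral>x. norm (f x) \<partial>M)))"
    using int B0 by (subst nn_integral_eq_integral) (simp_all add: eq)
  also have "\<dots> \<noteq> \<infinity>"
    using summable_mult2[OF summable, of "\<integral>x. norm (f x) \<partial>M"] w
    by (subst suminf_ennreal2) (auto intro!: mult_nonneg_nonneg sum_nonneg)
  finally have "AE x in M. (\<Sum>k. ennreal (?B k x)) \<noteq> \<infinity>"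
    using int by (intro nn_integral_noteq_infinite) auto
  then show ?thesis
  proof eventually_elim
    case (elim x)
    then have "summable (\<lambda>k. ?B k x)"
      using B0 by (intro summable_suminf_not_top) auto
    then show ?case by (rule summable_LIMSEQ_zero)
  qed
qed

text \<open>Birkhoff's theorem is applied to the truncations \<open>h m\<close> for all natural
  \<open>m\<close> at once, and \<rho> is the integral of \<open>h m\<close>. These integrals tend
  to \<open>0\<close> by dominated convergence.\<close>

lemma AE_large_values_average:
  fixes f :: "'a \<Rightarrow> 'b::{banach, second_countable_topology}"
  assumes f: "integrable M f"
  shows "AE x in M. \<forall>\<epsilon>>0. \<exists>m \<rho>. \<rho> < \<epsilon> \<and>
    (\<lambda>K. (\<Sum>n=1..K. norm (f ((T ^^ n) x)) * of_bool (norm (f ((T ^^ n) x)) > m)) / real K) \<longlonglongrightarrow> \<rho>"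
proof -
  define h where "h m x = norm (f x) * of_bool (norm (f x) > real m)" for m :: nat and x
  have [measurable]: "f \<in> borel_measurable M" using f by (rule borel_measurable_integrable)
  have [measurable]: "h m \<in> borel_measurable M" for m
    unfolding h_def by measurable
  have int: "integrable M (h m)" for m
    by (rule Bochner_Integration.integrable_bound[OF integrable_norm[OF f]]) (auto simp: h_def)
  have lim: "(\<lambda>m. \<integral>x. h m x \<partial>M) \<longlonglongrightarrow> (\<integral>x. 0 \<partial>M)"
  proof (rule integral_dominated_convergence[OF _ _ integrable_norm[OF f]])
    show "AE x in M. (\<lambda>m. h m x) \<longlonglongrightarrow> 0"
    proof (rule AE_I2)
      fix x
      obtain N :: nat where "norm (f x) \<le> real N" using real_arch_simple by blast
      then have "\<forall>\<^sub>F m in sequentially. 0 = h m x"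
        by (intro eventually_sequentiallyI[of N]) (auto simp: h_def)
      then show "(\<lambda>m. h m x) \<longlonglongrightarrow> 0"
        by (rule Lim_transform_eventually[OF tendsto_const])
    qed
    show "AE x in M. norm (h m x) \<le> norm (f x)" for m
      by (auto simp: h_def)
  qed auto
  have "AE x in M. \<forall>m. (\<lambda>K. (\<Sum>n=1..K. h m ((T ^^ n) x)) / real K) \<longlonglongrightarrow> (\<integral>x. h m x \<partial>M)"
    by (intro AE_all_countable[THEN iffD2] allI birkhoff_shifted int)
  then show ?thesis
  proof eventually_elim
    case (elim x)
    show ?case
    proof (intro allI impI)
      fix \<epsilon> :: real assume "\<epsilon> > 0"
      then have "\<forall>\<^sub>F m in sequentially. (\<integral>x. h m x \<partial>M) < \<epsilon>"
        using lim by (intro order_tendstoD(2)) auto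
      then obtain m where "(\<integral>x. h m x \<partial>M) < \<epsilon>"
        by (auto simp: eventually_sequentially)
      then show "\<exists>m \<rho>. \<rho> < \<epsilon> \<and>
          (\<lambda>K. (\<Sum>n=1..K. norm (f ((T ^^ n) x)) * of_bool (norm (f ((T ^^ n) x)) > m)) / real K) \<longlonglongrightarrow> \<rho>"
        using elim unfolding h_def by blast
    qed
  qed
qed

lemma weighted_ergodic:
  fixes g L :: "nat \<Rightarrow> real" and f :: "'a \<Rightarrow> complex"
  assumes f: "integrable M f"
    and g: "\<And>n. g n \<ge> 0" and C: "C \<ge> 0"
    and L: "mono L" "filterlim L at_top sequentially"
    and mean: "(\<lambda>K. (\<Sum>n=1..K. \<bar>g n - L K\<bar>) / (real K * L K)) \<longlonglongrightarrow> 0"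
    and tail: "summable (\<lambda>k. (\<Sum>n | n \<in> {1..2 ^ Suc k} \<and> g n > C * L (2 ^ k). g n) / 2 ^ k)"
  shows "AE x in M. (\<lambda>K. 1 / of_real (\<Sum>n=1..K. g n) * (\<Sum>n=1..K. of_real (g n) * f ((T ^^ n) x)))
      \<longlonglongrightarrow> (\<integral>x. f x \<partial>M)"
proof -
  let ?I = "\<lambda>k. {n. n \<in> {1..2 ^ Suc k} \<and> g n > C * L (2 ^ k)}"
  have fin: "finite (?I k)" for k
    by (rule finite_subset[of _ "{1..2 ^ Suc k}"]) auto
  have "AE x in M. (\<lambda>k. \<Sum>n\<in>?I k. g n / 2 ^ k * norm (f ((T ^^ n) x))) \<longlonglongrightarrow> 0"
    using g fin tail by (intro AE_tail_tendsto_0[OF f]) (simp_all add: sum_divide_distrib)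
  then show ?thesis
    using AE_large_values_average[OF f] birkhoff_complex[OF f]
  proof eventually_elim
    case (elim x)
    let ?a = "\<lambda>n. f ((T ^^ n) x)" and ?N = "\<lambda>K. complex_of_real (real K * L K)"
    have "(\<lambda>K. (\<Sum>n=1..K. (g n - L K) *\<^sub>R ?a n) /\<^sub>R (real K * L K)) \<longlonglongrightarrow> 0"
      using elim(1,2)
      by (intro weighted_average_diff_tendsto_0[OF g C L mean]) (simp_all add: sum_divide_distrib)
    \<comment> \<open>Adding back the constant weight \<open>L K\<close> turns the normalized
      difference into the weighted average; after division by \<open>K * L K\<close> the added part
      is the plain Birkhoff average.\<close>
    then have num: "(\<lambda>K. (\<Sum>n=1..K. (g n - L K) *\<^sub>R ?a n) /\<^sub>R (real K * L K) + (\<Sum>n=1..K. ?a n) / of_nat K)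
        \<longlonglongrightarrow> 0 + (\<integral>x. f x \<partial>M)"
      by (intro tendsto_add elim(3))
    have pos: "\<forall>\<^sub>F K in sequentially. real K * L K > 0"
      using eventually_gt_at_top[of 0] L(2)[unfolded filterlim_at_top_dense, rule_format, of 0]
      by eventually_elim simp
    \<comment> \<open>The same mean deviation shows that \<open>K * L K\<close> may be replaced by
      the total weight.\<close>
    have "(\<lambda>K. (\<Sum>n=1..K. g n) / (real K * L K) - 1) \<longlonglongrightarrow> 0"
    proof (rule tendsto_rabs_zero_cancel, rule tendsto_sandwich[OF _ _ tendsto_const mean])
      show "\<forall>\<^sub>F K in sequentially. \<bar>(\<Sum>n=1..K. g n) / (real K * L K) - 1\<bar>
          \<le> (\<Sum>n=1..K. \<bar>g n - L K\<bar>) / (real K * L K)"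
        using pos
      proof eventually_elim
        case (elim K)
        then have "K > 0" "L K \<noteq> 0" by (auto simp: zero_less_mult_iff)
        then have "(\<Sum>n=1..K. g n) / (real K * L K) - 1 = (\<Sum>n=1..K. g n - L K) / (real K * L K)"
          by (simp add: sum_subtractf diff_divide_distrib)
        then show ?case
          using elim by (simp add: divide_right_mono sum_abs abs_divide)
      qed
    qed simp
    then have den: "(\<lambda>K. complex_of_real ((\<Sum>n=1..K. g n) / (real K * L K))) \<longlonglongrightarrow> of_real 1"
      by (intro tendsto_of_real) (simp add: LIM_zero_iff)
    have "(\<lambda>K. ((\<Sum>n=1..K. (g n - L K) *\<^sub>R ?a n) /\<^sub>R (real K * L K) + (\<Sum>n=1..K. ?a n) / of_nat K)
        / complex_of_real ((\<Sum>n=1..K. g n) / (real K * L K))) \<longlonglongrightarrow> (0 + (\<integral>x. f x \<partial>M)) / of_real 1"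
      by (intro tendsto_divide num den) simp
    moreover have "\<forall>\<^sub>F K in sequentially.
        ((\<Sum>n=1..K. (g n - L K) *\<^sub>R ?a n) /\<^sub>R (real K * L K) + (\<Sum>n=1..K. ?a n) / of_nat K)
        / complex_of_real ((\<Sum>n=1..K. g n) / (real K * L K))
        = 1 / of_real (\<Sum>n=1..K. g n) * (\<Sum>n=1..K. of_real (g n) * ?a n)"
      using pos
    proof eventually_elim
      case (elim K)
      then have N: "?N K \<noteq> 0" "L K \<noteq> 0" "K > 0"
        by (auto simp: zero_less_mult_iff)
      have "(\<Sum>n=1..K. (g n - L K) *\<^sub>R ?a n) = (\<Sum>n=1..K. of_real (g n) * ?a n) - of_real (L K) * (\<Sum>n=1..K. ?a n)"
        by (simp add: scaleR_conv_of_real sum_subtractf sum_distrib_left algebra_simps)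
      then have "(\<Sum>n=1..K. (g n - L K) *\<^sub>R ?a n) /\<^sub>R (real K * L K) + (\<Sum>n=1..K. ?a n) / of_nat K
          = (\<Sum>n=1..K. of_real (g n) * ?a n) / ?N K"
        using N by (simp add: scaleR_conv_of_real field_simps)
      moreover have "complex_of_real ((\<Sum>n=1..K. g n) / (real K * L K)) = of_real (\<Sum>n=1..K. g n) / ?N K"
        by (rule of_real_divide)
      ultimately show ?case using N(1) by (simp del: of_real_mult of_real_sum)
    qed
    ultimately show ?case
      by (simp add: Lim_transform_eventually del: of_real_sum)
  qed
qed

end

section \<open>The weight hypotheses for \<open>prime_omega\<close> and
  \<open>prime_Omega\<close>\<close>

lemma zeta_const_nonneg: "zeta_const \<ge> 0"
  using sum_sqrt_div_square_le[of 0] by simp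

text \<open>The constant \<open>c\<close> makes room for an excess linear in \<open>K\<close>, such
  as that of \<open>prime_Omega\<close> over \<open>prime_omega\<close>.\<close>

lemma mean_deviation_tendsto_0:
  assumes "\<And>K. prime_recip_sum K > 0 \<Longrightarrow>
    (\<Sum>n=1..K. \<bar>g n - prime_recip_sum K\<bar>) \<le> (4 * sqrt (prime_recip_sum K) + c) * real K"
  shows "(\<lambda>K. (\<Sum>n=1..K. \<bar>g n - prime_recip_sum K\<bar>) / (real K * prime_recip_sum K)) \<longlonglongrightarrow> 0"
proof (rule tendsto_sandwich[OF _ _ tendsto_const])
  let ?L = prime_recip_sum
  show "\<forall>\<^sub>F K in sequentially. 0 \<le> (\<Sum>n=1..K. \<bar>g n - ?L K\<bar>) / (real K * ?L K)"
    by (intro always_eventually allI divide_nonneg_nonneg sum_nonneg mult_nonneg_nonneg prime_recip_sum_nonneg) auto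
  have "filterlim (\<lambda>K. sqrt (?L K)) at_top sequentially"
    by (rule filterlim_compose[OF sqrt_at_top prime_recip_sum_at_top])
  then have "(\<lambda>K. 4 / sqrt (?L K) + c / ?L K) \<longlonglongrightarrow> 0 + 0"
    by (intro tendsto_add real_tendsto_divide_at_top[OF tendsto_const] prime_recip_sum_at_top)
  then show "(\<lambda>K. 4 / sqrt (?L K) + c / ?L K) \<longlonglongrightarrow> 0" by simp
  show "\<forall>\<^sub>F K in sequentially. (\<Sum>n=1..K. \<bar>g n - ?L K\<bar>) / (real K * ?L K) \<le> 4 / sqrt (?L K) + c / ?L K"
    using eventually_gt_at_top[of 0] prime_recip_sum_at_top[unfolded filterlim_at_top_dense, rule_format, of 0]
  proof eventually_elim
    case (elim K)
    then have "(\<Sum>n=1..K. \<bar>g n - ?L K\<bar>) / (real K * ?L K) \<le> (4 * sqrt (?L K) + c) * real K / (real K * ?L K)"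
      by (intro divide_right_mono assms) auto
    also have "\<dots> = 4 * (sqrt (?L K) / ?L K) + c / ?L K"
      using elim by (simp add: field_simps)
    also have "sqrt (?L K) / ?L K = 1 / sqrt (?L K)"
      using elim by (simp add: sqrt_divide_self_eq inverse_eq_divide)
    finally show ?case by simp
  qed
qed

text \<open>An exponential Chebyshev bound: beyond the cut, \<open>g n\<close> is at most a constant
  times \<open>exp (- 3 * L) * exp (\<delta> * prime_Omega n)\<close>, with \<open>L\<close> the
  reciprocal sum at \<open>2 ^ k\<close>. Since \<open>exp (- L)\<close> is of order at most
  \<open>1 / k\<close>, its cube outweighs the factor \<open>k\<close> from the exponential moment
  and leaves the summable \<open>1 / k^2\<close>.\<close>

lemma tail_summable:
  fixes g :: "nat \<Rightarrow> nat"
  assumes g: "\<And>n. g n \<le> prime_Omega n"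
  shows "summable (\<lambda>k. (\<Sum>n | n \<in> {1..2 ^ Suc k} \<and> real (g n) > 24 / ln 2 * prime_recip_sum (2 ^ k). real (g n)) / 2 ^ k)"
proof (rule summable_comparison_test')
  define \<delta> :: real where "\<delta> = ln 2 / 4"
  \<comment> \<open>The cut is \<open>6 / \<delta>\<close> so that half of the exponent,
    \<open>\<delta> / 2 * g n\<close>, is at least \<open>3 * ?L\<close>; the other half bounds
    \<open>g n\<close> itself.\<close>
  have \<delta>: "\<delta> > 0" "24 / ln 2 = 6 / \<delta>" by (auto simp: \<delta>_def)
  define c where "c = 2 / \<delta> * (2 / ln 2) ^ 3 * (2 * zeta_const * 3)"
  show "summable (\<lambda>k. c * inverse (real k ^ 2))"
    by (intro summable_mult inverse_power_summable) simp
  fix k :: nat assume k: "k \<ge> 1"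
  let ?L = "prime_recip_sum (2 ^ k)"
  let ?I = "{n. n \<in> {1..2 ^ Suc k} \<and> real (g n) > 24 / ln 2 * ?L}"
  have "(\<Sum>n\<in>?I. real (g n)) \<le> (\<Sum>n\<in>?I. 2 / \<delta> * exp (- 3 * ?L) * exp (\<delta> * real (prime_Omega n)))"
  proof (rule sum_mono)
    fix n assume "n \<in> ?I"
    then have "real (g n) \<ge> 6 / \<delta> * ?L" using \<delta>(2) by auto
    then have "\<delta> / 2 * real (g n) \<ge> \<delta> / 2 * (6 / \<delta> * ?L)"
      using \<delta>(1) by (intro mult_left_mono) auto
    then have 3: "\<delta> / 2 * real (g n) \<ge> 3 * ?L" using \<delta>(1) by simp
    have "real (g n) \<le> exp (\<delta> / 2 * real (g n)) / (\<delta> / 2)"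
      using \<delta>(1) by (intro le_exp_div) simp
    also have "\<dots> \<le> exp (- 3 * ?L + \<delta> * real (g n)) / (\<delta> / 2)"
      using 3 \<delta>(1) by (intro divide_right_mono) auto
    also have "\<dots> \<le> exp (- 3 * ?L + \<delta> * real (prime_Omega n)) / (\<delta> / 2)"
      using g[of n] \<delta>(1) by (intro divide_right_mono) auto
    also have "\<dots> = 2 / \<delta> * exp (- 3 * ?L) * exp (\<delta> * real (prime_Omega n))"
      by (simp only: exp_add) simp
    finally show "real (g n) \<le> 2 / \<delta> * exp (- 3 * ?L) * exp (\<delta> * real (prime_Omega n))" .
  qed
  also have "\<dots> \<le> (\<Sum>n=1..2 ^ Suc k. 2 / \<delta> * exp (- 3 * ?L) * exp (\<delta> * real (prime_Omega n)))"
    using \<delta>(1) by (intro sum_mono2) auto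
  also have "\<dots> = 2 / \<delta> * exp (- 3 * ?L) * (\<Sum>n=1..2 ^ Suc k. exp (ln 2 / 4 * real (prime_Omega n)))"
    by (simp only: sum_distrib_left \<delta>_def)
  also have "\<dots> \<le> 2 / \<delta> * (2 / (real k * ln 2)) ^ 3 * (zeta_const * real (2 ^ Suc k) * (3 * real k))"
  proof (intro mult_mono mult_nonneg_nonneg)
    have "ln (real (2 ^ k)) \<le> 2 * exp ?L" by (rule ln_le_exp_prime_recip_sum) simp
    then have "real k * ln 2 \<le> 2 * exp ?L" by (simp add: ln_realpow)
    then have "exp (- ?L) \<le> 2 / (real k * ln 2)"
      using k by (simp add: exp_minus field_simps)
    then have "exp (- ?L) ^ 3 \<le> (2 / (real k * ln 2)) ^ 3"
      by (intro power_mono) auto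
    moreover have "exp (- ?L) ^ 3 = exp (- 3 * ?L)"
      by (simp flip: exp_of_nat_mult)
    ultimately show "exp (- 3 * ?L) \<le> (2 / (real k * ln 2)) ^ 3" by simp
    have "1 + ln (real (2 ^ Suc k)) \<le> 1 + real (Suc k) * 1"
      using ln_2_less_1 by (simp only: of_nat_power of_nat_numeral ln_realpow) (intro add_mono mult_left_mono, auto)
    also have "\<dots> \<le> 3 * real k" using k by simp
    finally have "1 + ln (real (2 ^ Suc k)) \<le> 3 * real k" .
    then have "zeta_const * real (2 ^ Suc k) * (1 + ln (real (2 ^ Suc k))) \<le> zeta_const * real (2 ^ Suc k) * (3 * real k)"
      using zeta_const_nonneg by (intro mult_left_mono) auto
    with sum_exp_prime_Omega_le[of "2 ^ Suc k"]
    show "(\<Sum>n=1..2 ^ Suc k. exp (ln 2 / 4 * real (prime_Omega n))) \<le> zeta_const * real (2 ^ Suc k) * (3 * real k)"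
      by linarith
  qed (use \<delta>(1) in \<open>auto intro: sum_nonneg\<close>)
  also have "\<dots> = c * inverse (real k ^ 2) * 2 ^ k"
    using k by (simp add: c_def field_simps power2_eq_square power3_eq_cube)
  finally have "(\<Sum>n\<in>?I. real (g n)) / 2 ^ k \<le> c * inverse (real k ^ 2)"
    by (simp add: field_simps)
  then show "norm ((\<Sum>n\<in>?I. real (g n)) / 2 ^ k) \<le> c * inverse (real k ^ 2)"
    by (simp add: sum_nonneg)
qed

theorem theorem6:
  fixes g :: "nat \<Rightarrow> nat" and M :: "'a measure" and T :: "'a \<Rightarrow> 'a"
    and f :: "'a \<Rightarrow> complex"
  assumes "g = prime_omega \<or> g = prime_Omega"
    and "ergodic_system M T"
    and "integrable M f"
  shows "AE x in M.
    (\<lambda>K. 1 / of_nat (weight_sum g K) * (\<Sum>n=1..K. of_nat (g n) * f ((T ^^ n) x)))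
      \<longlonglongrightarrow> (\<integral>x. f x \<partial>M)"
proof -
  interpret ergodic_system M T by fact
  let ?c = "8 / ln 2 * zeta_const"
  have "(\<Sum>n=1..K. \<bar>real (g n) - prime_recip_sum K\<bar>) \<le> (4 * sqrt (prime_recip_sum K) + ?c) * real K"
    if pos: "prime_recip_sum K > 0" for K
  proof -
    \<comment> \<open>Either choice of \<open>g\<close> differs from \<open>prime_omega\<close> by
      at most the excess of \<open>prime_Omega\<close>, so both cases are treated together.\<close>
    have "(\<Sum>n=1..K. \<bar>real (g n) - prime_recip_sum K\<bar>)
        \<le> (\<Sum>n=1..K. \<bar>real (prime_omega n) - prime_recip_sum K\<bar> + (real (prime_Omega n) - real (prime_omega n)))"
    proof (rule sum_mono)
      fix n
      show "\<bar>real (g n) - prime_recip_sum K\<bar> \<le> \<bar>real (prime_omega n) - prime_recip_sum K\<bar>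
          + (real (prime_Omega n) - real (prime_omega n))"
        using assms(1) prime_omega_le_Omega[of n] by auto
    qed
    also have "\<dots> \<le> 4 * sqrt (prime_recip_sum K) * real K + 4 / ln 2 * zeta_const * real K"
      unfolding sum.distrib
      by (intro add_mono sum_abs_prime_omega_diff_le[OF pos] sum_prime_Omega_diff_omega_le)
    also have "\<dots> \<le> (4 * sqrt (prime_recip_sum K) + ?c) * real K"
      using zeta_const_nonneg by (simp add: field_simps)
    finally show ?thesis .
  qed
  then have mean: "(\<lambda>K. (\<Sum>n=1..K. \<bar>real (g n) - prime_recip_sum K\<bar>) / (real K * prime_recip_sum K)) \<longlonglongrightarrow> 0"
    by (rule mean_deviation_tendsto_0)
  have "g n \<le> prime_Omega n" for n
    using assms(1) prime_omega_le_Omega by auto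
  note tail = tail_summable[OF this]
  have "mono prime_recip_sum" by (intro monoI prime_recip_sum_mono)
  from weighted_ergodic[OF assms(3) _ _ this prime_recip_sum_at_top mean tail]
  show ?thesis by (simp add: weight_sum_def)
qed

end
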